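(* Let $U\subset\mathbb{R}$ be a compact connected set (interval) of positive Lebesgue measure, let $\phi(z)=z^Tz$ on $\mathbb{R}^n$, and let $f:U\to\mathbb{R}^n$ be bounded and measurable. For each integer $N\ge1$, partition $U$ into $N$ consecutive intervals $U_1^{N},\ldots,U_N^{N}$ of identical Lebesgue measure $\mu(U)/N$ (overlapping at most at endpoints), and set $$\mathcal{J}_i^{N}:=-\mu(U_i^{N})^{-1}\,\phi\left(\int_{U_i^{N}}f(s)\,ds\right),\qquad i=1,\ldots,N.$$ Then $$\sum_{i=1}^N\mathcal{J}_i^{N}\longrightarrow\mathcal{S}(U):=-\int_U\phi(f(s))\,ds\qquad\text{as }N\to+\infty.$$
   Context: $\mu$ denotes the Lebesgue measure on $\mathbb{R}$. Each $\mathcal{J}_i^N$ is the Jensen upper bound of $-\int_{U_i^N}\phi(f(s))\,ds$. Integrals of vector-valued functions are taken componentwise. *)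

theory Defs
  imports "HOL-Analysis.Analysis"
begin

definition phi :: "real ^ 'n \<Rightarrow> real" where
  "phi z = z \<bullet> z"

definition vec_integral :: "real set \<Rightarrow> (real \<Rightarrow> real ^ 'n) \<Rightarrow> real ^ 'n" where
  "vec_integral A f = (\<chi> k. LINT s:A|lebesgue. f s $ k)"

definition jensen_bound :: "(real \<Rightarrow> real ^ 'n) \<Rightarrow> real set \<Rightarrow> real" where
  "jensen_bound f A = - (inverse (measure lebesgue A) * phi (vec_integral A f))"

definition S_integral :: "(real \<Rightarrow> real ^ 'n) \<Rightarrow> real set \<Rightarrow> real" where
  "S_integral f A = - (LINT s:A|lebesgue. phi (f s))"

(* The pieces may be open, closed or half-open. The ordering clause says that they are
   consecutive; it also forces two distinct pieces to share at most one point, which is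
   then an endpoint of both. *)
definition equal_interval_partition :: "real set \<Rightarrow> nat \<Rightarrow> (nat \<Rightarrow> real set) \<Rightarrow> bool" where
  "equal_interval_partition U N V \<longleftrightarrow>
     (\<Union>i\<in>{1..N}. V i) = U \<and>
     (\<forall>i\<in>{1..N}. is_interval (V i) \<and> measure lebesgue (V i) = measure lebesgue U / real N) \<and>
     (\<forall>i\<in>{1..N}. \<forall>j\<in>{1..N}. i < j \<longrightarrow> (\<forall>x\<in>V i. \<forall>y\<in>V j. x \<le> y))"

end

theory Submission
  imports Defs
begin

text \<open>On a piece \<open>A\<close> the gap between the Jensen bound and the exact value is the minimum over
  constants \<open>c\<close> of the integral of \<open>|f - c|\<^sup>2\<close>, attained at the mean of \<open>f\<close>. Hence it is nonnegative
  and can be bounded by choosing \<open>c = h a\<close> for some \<open>a\<close> in \<open>A\<close>, where \<open>h\<close> is a continuous function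
  close to \<open>f\<close> in \<open>L\<^sup>2(U)\<close>: uniform continuity of \<open>h\<close> makes \<open>|h - h a|\<close> small on all pieces once
  \<open>N\<close> is large.\<close>

section \<open>Bounded functions and set integrals over sets of finite measure\<close>

lemma set_integrable_bounded_lebesgue:
  fixes f :: "'a::euclidean_space \<Rightarrow> 'b::euclidean_space"
  assumes S: "S \<in> lmeasurable" and f: "f \<in> borel_measurable (lebesgue_on S)"
    and B: "\<And>x. x \<in> S \<Longrightarrow> norm (f x) \<le> B"
  shows "set_integrable lebesgue S f"
proof -
  interpret finite_measure "lebesgue_on S"
    by (rule finite_measure_lebesgue_on[OF S])
  have "integrable (lebesgue_on S) f"
    using f B by (intro integrable_const_bound[where B = B] AE_I2) (auto simp: space_restrict_space)
  then show ?thesis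
    using S by (subst set_integrable_eq) (auto simp: fmeasurableD)
qed

lemma set_integrable_norm_diff_square:
  fixes f g :: "'a::euclidean_space \<Rightarrow> 'b::euclidean_space"
  assumes S: "S \<in> lmeasurable"
    and f: "f \<in> borel_measurable (lebesgue_on S)" and g: "g \<in> borel_measurable (lebesgue_on S)"
    and B: "\<And>x. x \<in> S \<Longrightarrow> norm (f x) \<le> B" and C: "\<And>x. x \<in> S \<Longrightarrow> norm (g x) \<le> C"
  shows "set_integrable lebesgue S (\<lambda>x. (norm (f x - g x))\<^sup>2)"
proof (rule set_integrable_bounded_lebesgue[OF S, where B = "(B + C)\<^sup>2"])
  show "(\<lambda>x. (norm (f x - g x))\<^sup>2) \<in> borel_measurable (lebesgue_on S)"
    using f g by measurable
  fix x assume "x \<in> S"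
  then have "norm (f x - g x) \<le> B + C"
    using B C norm_triangle_ineq4[of "f x" "g x"] by (smt (verit))
  then show "norm ((norm (f x - g x))\<^sup>2) \<le> (B + C)\<^sup>2"
    by (simp add: power_mono)
qed

text \<open>Expanding the square and integrating termwise gives a quadratic polynomial in
  \<open>c\<close>. In this form the square can be completed later, which exhibits the mean of
  \<open>f\<close> as the minimiser.\<close>

lemma LINT_norm_diff_const_square:
  fixes f :: "'a::euclidean_space \<Rightarrow> 'b::euclidean_space"
  assumes A: "A \<in> lmeasurable" and f: "set_integrable lebesgue A f"
    and f2: "set_integrable lebesgue A (\<lambda>x. (norm (f x))\<^sup>2)"
  shows "(LINT x:A|lebesgue. (norm (f x - c))\<^sup>2) =
    (LINT x:A|lebesgue. (norm (f x))\<^sup>2) - 2 * ((LINT x:A|lebesgue. f x) \<bullet> c)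
      + (norm c)\<^sup>2 * measure lebesgue A"
proof -
  have eq: "(norm (f x - c))\<^sup>2 = (norm (f x))\<^sup>2 - 2 * (f x \<bullet> c) + (norm c)\<^sup>2" for x
    by (simp add: power2_norm_eq_inner inner_diff_left inner_diff_right inner_commute)
  have i: "set_integrable lebesgue A (\<lambda>x. f x \<bullet> c)"
    using f integrable_inner_left[of c lebesgue "\<lambda>x. indicator A x *\<^sub>R f x"]
    by (simp add: set_integrable_def)
  have i2: "set_integrable lebesgue A (\<lambda>x. 2 * (f x \<bullet> c))"
    using i by simp
  have k: "set_integrable lebesgue A (\<lambda>x. (norm c)\<^sup>2)"
    using A by (intro set_integrable_bounded_lebesgue) auto
  have "(LINT x:A|lebesgue. f x \<bullet> c) = (LINT x:A|lebesgue. f x) \<bullet> c"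
    using f integral_inner_left[of c lebesgue "\<lambda>x. indicator A x *\<^sub>R f x"]
    by (simp add: set_integrable_def set_lebesgue_integral_def)
  moreover have "(LINT x:A|lebesgue. (norm c)\<^sup>2) = (norm c)\<^sup>2 * measure lebesgue A"
    using A by (simp add: set_lebesgue_integral_def fmeasurableD)
  ultimately show ?thesis
    unfolding eq
    by (subst set_integral_add(2)[OF set_integral_diff(1)[OF f2 i2] k],
        subst set_integral_diff(2)[OF f2 i2]) simp
qed

text \<open>Adjacent pieces may share an endpoint, so additivity over disjoint sets does not apply
  directly. The gauge integral is additive up to negligible overlaps
  (\<open>has_integral_UN\<close>), and uniqueness of its value carries the identity back to
  Lebesgue integrals.\<close>

lemma LINT_Union_negligible_overlap:
  fixes f :: "'a::euclidean_space \<Rightarrow> real"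
  assumes "finite I" and f: "set_integrable lebesgue (\<Union>i\<in>I. A i) f"
    and meas: "\<And>i. i \<in> I \<Longrightarrow> A i \<in> sets lebesgue"
    and negl: "pairwise (\<lambda>i j. negligible (A i \<inter> A j)) I"
  shows "(LINT x:(\<Union>i\<in>I. A i)|lebesgue. f x) = (\<Sum>i\<in>I. LINT x:A i|lebesgue. f x)"
proof -
  have *: "set_integrable lebesgue (A i) f" if "i \<in> I" for i
    using set_integrable_subset[OF f] meas that by blast
  have "(f has_integral (\<Sum>i\<in>I. LINT x:A i|lebesgue. f x)) (\<Union>i\<in>I. A i)"
    using \<open>finite I\<close> * negl by (intro has_integral_UN has_integral_set_lebesgue) auto
  moreover have "(f has_integral (LINT x:(\<Union>i\<in>I. A i)|lebesgue. f x)) (\<Union>i\<in>I. A i)"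
    using f by (rule has_integral_set_lebesgue)
  ultimately show ?thesis
    by (rule has_integral_unique[symmetric])
qed

section \<open>Approximation of bounded measurable functions by continuous ones\<close>

lemma L2_approx_by_continuous:
  fixes f :: "'a::euclidean_space \<Rightarrow> 'b::euclidean_space"
  assumes S: "S \<in> lmeasurable" and f: "f \<in> borel_measurable (lebesgue_on S)"
    and "bounded (f ` S)" and "e > 0"
  obtains h where "continuous_on UNIV h" "bounded (range h)"
    "(LINT x:S|lebesgue. (norm (f x - h x))\<^sup>2) < e"
proof -
  obtain B where B: "B > 0" "\<And>x. x \<in> S \<Longrightarrow> norm (f x) \<le> B"
    using \<open>bounded (f ` S)\<close> by (auto simp: bounded_pos)
  have Ss: "S \<in> sets lebesgue"
    using S by (simp add: fmeasurableD)
  \<comment> \<open>Measurability in this form supplies continuous approximants that converge almost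
    everywhere; dominated convergence then turns this into convergence in mean square.\<close>
  have "f measurable_on S"
    using f Ss measurable_on_iff_borel_measurable by blast
  then obtain N g where N: "negligible N" and g: "\<And>n. continuous_on UNIV (g n)"
    and lim: "\<And>x. x \<notin> N \<Longrightarrow> (\<lambda>n. g n x) \<longlonglongrightarrow> (if x \<in> S then f x else 0)"
    unfolding measurable_on_def by blast
  \<comment> \<open>Projecting the approximants to the ball that contains the values of \<open>f\<close> keeps them
    continuous and makes dominated convergence applicable.\<close>
  define p :: "'b \<Rightarrow> 'b" where "p = closest_point (cball 0 B)"
  have p: "continuous_on UNIV p"
    unfolding p_def using B by (intro continuous_on_closest_point) auto
  have pB: "norm (p y) \<le> B" for y
    using closest_point_in_set[of "cball (0::'b) B" y] B by (auto simp: p_def)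
  have pid: "p y = y" if "norm y \<le> B" for y
    using that by (simp add: p_def closest_point_self)
  define h where "h n x = p (g n x)" for n x
  have h: "continuous_on UNIV (h n)" for n
    unfolding h_def using continuous_on_compose2[OF p g] by blast
  have hm: "h n \<in> borel_measurable (lebesgue_on S)" for n
    using h Ss continuous_on_subset by (blast intro: continuous_imp_measurable_on_sets_lebesgue)
  have int: "set_integrable lebesgue S (\<lambda>x. (norm (f x - h n x))\<^sup>2)" for n
    using B pB by (intro set_integrable_norm_diff_square[OF S f hm]) (auto simp: h_def)
  \<comment> \<open>On \<open>S\<close> both \<open>f\<close> and \<open>h n\<close> are bounded by
    \<open>B\<close>, so the integrands are dominated by the constant
    \<open>(B + B)\<^sup>2\<close>, integrable because \<open>S\<close> has finite measure.\<close>
  have "(\<lambda>n. LINT x:S|lebesgue. (norm (f x - h n x))\<^sup>2) \<longlonglongrightarrow> (LINT (x::'a)|lebesgue. (0::real))"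
    unfolding set_lebesgue_integral_def
  proof (rule integral_dominated_convergence[where w = "\<lambda>x. indicator S x *\<^sub>R (B + B)\<^sup>2"])
    show "(\<lambda>x. indicator S x *\<^sub>R (norm (f x - h n x))\<^sup>2) \<in> borel_measurable lebesgue" for n
      using int[of n] unfolding set_integrable_def by (rule borel_measurable_integrable)
    show "integrable lebesgue (\<lambda>x. indicator S x *\<^sub>R (B + B)\<^sup>2)"
      using set_integrable_bounded_lebesgue[OF S, of "\<lambda>x. (B + B)\<^sup>2" "(B + B)\<^sup>2"]
      by (simp add: set_integrable_def)
    show "AE x in lebesgue. norm (indicator S x *\<^sub>R (norm (f x - h n x))\<^sup>2)
        \<le> indicator S x *\<^sub>R (B + B)\<^sup>2" for n
    proof (rule AE_I2)
      fix x
      have "norm (f x - h n x) \<le> B + B" if "x \<in> S"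
        using B(2)[OF that] pB[of "g n x"] norm_triangle_ineq4[of "f x" "h n x"]
        by (simp add: h_def)
      then have "(norm (f x - h n x))\<^sup>2 \<le> (B + B)\<^sup>2" if "x \<in> S"
        using that by (blast intro: power_mono norm_ge_zero)
      then show "norm (indicator S x *\<^sub>R (norm (f x - h n x))\<^sup>2) \<le> indicator S x *\<^sub>R (B + B)\<^sup>2"
        by (cases "x \<in> S") simp_all
    qed
    have "AE x in lebesgue. x \<notin> N"
      using N by (intro AE_not_in) (simp add: negligible_iff_null_sets)
    then show "AE x in lebesgue. (\<lambda>n. indicator S x *\<^sub>R (norm (f x - h n x))\<^sup>2) \<longlonglongrightarrow> 0"
    proof eventually_elim
      case (elim x)
      show ?case
      proof (cases "x \<in> S")
        case True
        \<comment> \<open>The projection fixes \<open>f x\<close>, whose norm is at most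
          \<open>B\<close>; hence continuity of \<open>p\<close> there transfers the limit from
          \<open>g n x\<close> to \<open>h n x\<close>.\<close>
        have "isCont p (f x)"
          using p by (simp add: continuous_on_eq_continuous_at)
        then have "(\<lambda>n. h n x) \<longlonglongrightarrow> f x"
          using isCont_tendsto_compose lim[OF elim] True pid B(2) unfolding h_def by fastforce
        then have "(\<lambda>n. (norm (f x - h n x))\<^sup>2) \<longlonglongrightarrow> (norm (f x - f x))\<^sup>2"
          by (intro tendsto_intros)
        then show ?thesis
          using True by simp
      qed simp
    qed
  qed simp
  then have "eventually (\<lambda>n. (LINT x:S|lebesgue. (norm (f x - h n x))\<^sup>2) < e) sequentially"
    using \<open>e > 0\<close> by (intro order_tendstoD) auto
  then obtain n where "(LINT x:S|lebesgue. (norm (f x - h n x))\<^sup>2) < e"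
    using eventually_happens' sequentially_bot by blast
  moreover have "bounded (range (h n))"
    using pB by (auto simp: bounded_iff h_def)
  ultimately show thesis
    using that h by blast
qed

section \<open>The Jensen bound on a single piece\<close>

lemma vec_integral_eq_LINT:
  assumes "set_integrable lebesgue A f"
  shows "vec_integral A f = (LINT x:A|lebesgue. f x)"
proof -
  \<comment> \<open>A component is the inner product with \<open>axis k 1\<close>, and inner
    products with a fixed vector commute with the Bochner integral.\<close>
  have "(LINT s:A|lebesgue. f s $ k) = (LINT x:A|lebesgue. f x) $ k" for k
    using assms integral_inner_left[of "axis k 1" lebesgue "\<lambda>x. indicator A x *\<^sub>R f x"]
    by (simp add: set_integrable_def set_lebesgue_integral_def inner_axis)
  then show ?thesis
    by (simp add: vec_integral_def vec_eq_iff)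
qed

text \<open>An interval contains the segment between any two of its points. This converts the
  prescribed measure of a piece into a bound on its diameter, as uniform continuity
  requires.\<close>

lemma dist_le_measure_interval:
  fixes A :: "real set"
  assumes "is_interval A" "A \<in> lmeasurable" "x \<in> A" "y \<in> A"
  shows "\<bar>x - y\<bar> \<le> measure lebesgue A"
proof -
  have "b - a \<le> measure lebesgue A" if ab: "a \<in> A" "b \<in> A" "a \<le> b" for a b
  proof -
    have "{a..b} \<subseteq> A"
      using mem_is_interval_1_I[OF assms(1) ab(1,2)] by (simp add: subset_iff)
    then have "measure lebesgue {a..b} \<le> measure lebesgue A"
      using assms(2) by (intro measure_mono_fmeasurable) auto
    then show ?thesis
      using ab(3) by simp
  qed
  from this[of x y] this[of y x] show ?thesis
    using assms(3,4) by linarith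
qed

lemma jensen_bound_defect:
  fixes f :: "real \<Rightarrow> real ^ 'n"
  assumes A: "A \<in> lmeasurable" and m: "measure lebesgue A > 0"
    and f: "set_integrable lebesgue A f"
    and f2: "set_integrable lebesgue A (\<lambda>x. (norm (f x))\<^sup>2)"
  shows "S_integral f A \<le> jensen_bound f A"
    and "jensen_bound f A - S_integral f A \<le> (LINT x:A|lebesgue. (norm (f x - c))\<^sup>2)"
proof -
  define m I Q where "m = measure lebesgue A" and "I = (LINT x:A|lebesgue. f x)"
    and "Q = (LINT x:A|lebesgue. (norm (f x))\<^sup>2)"
  have mp: "m > 0"
    using m by (simp add: m_def)
  have D: "(LINT x:A|lebesgue. (norm (f x - c))\<^sup>2) = Q - 2 * (I \<bullet> c) + (norm c)\<^sup>2 * m" for c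
    unfolding Q_def I_def m_def using A f f2 by (rule LINT_norm_diff_const_square)
  have j: "jensen_bound f A - S_integral f A = Q - (norm I)\<^sup>2 / m"
    by (simp add: jensen_bound_def S_integral_def vec_integral_eq_LINT[OF f] phi_def
        power2_norm_eq_inner m_def I_def Q_def divide_inverse_commute)
  \<comment> \<open>Completing the square in \<open>c\<close>: the bracket is the defect from
    \<open>j\<close>. Taking \<open>c\<close> to be the mean \<open>I /\<^sub>R m\<close> shows that
    it is nonnegative; for any other \<open>c\<close> the last term only adds to it.\<close>
  have *: "(LINT x:A|lebesgue. (norm (f x - c))\<^sup>2) = (Q - (norm I)\<^sup>2 / m) + m * (norm (c - I /\<^sub>R m))\<^sup>2"
    for c
    unfolding D using mp
    by (simp add: power2_norm_eq_inner inner_diff_left inner_diff_right inner_commute field_simps)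
  have "0 \<le> (LINT x:A|lebesgue. (norm (f x - I /\<^sub>R m))\<^sup>2)"
    unfolding set_lebesgue_integral_def by (intro integral_nonneg_AE) simp
  then show "S_integral f A \<le> jensen_bound f A"
    using j *[of "I /\<^sub>R m"] by simp
  show "jensen_bound f A - S_integral f A \<le> (LINT x:A|lebesgue. (norm (f x - c))\<^sup>2)"
    using j *[of c] mp by simp
qed

section \<open>Convergence of the sums of Jensen bounds\<close>

theorem mainTheorem3:
  fixes U :: "real set"
    and f :: "real \<Rightarrow> real ^ 'n"
    and V :: "nat \<Rightarrow> nat \<Rightarrow> real set"
  assumes "compact U" and "connected U" and "measure lebesgue U > 0"
    and "f \<in> borel_measurable (lebesgue_on U)"
    and "bounded (f ` U)"
    and "\<And>N. N \<ge> 1 \<Longrightarrow> equal_interval_partition U N (V N)"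
  shows "(\<lambda>N. \<Sum>i=1..N. jensen_bound f (V N i)) \<longlonglongrightarrow> S_integral f U"
proof (rule LIMSEQ_I)
  fix r :: real
  assume "r > 0"
  define \<mu> where "\<mu> = measure lebesgue U"
  have \<mu>: "\<mu> > 0"
    using assms(3) by (simp add: \<mu>_def)
  \<comment> \<open>The error budget has two terms: twice the squared distance of \<open>f\<close>
    to \<open>h\<close>, kept below \<open>r / 2\<close>, and \<open>2 * e\<^sup>2 * \<mu>\<close>,
    which this choice makes equal to \<open>r / 2\<close>.\<close>
  define e where "e = sqrt (r / (4 * \<mu>))"
  have e: "e > 0" "e\<^sup>2 * \<mu> = r / 4"
    using \<open>r > 0\<close> \<mu> by (simp_all add: e_def)
  have Um: "U \<in> lmeasurable"
    using \<open>compact U\<close> by (rule lmeasurable_compact)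
  obtain B where B: "\<And>x. x \<in> U \<Longrightarrow> norm (f x) \<le> B"
    using \<open>bounded (f ` U)\<close> by (auto simp: bounded_iff)
  have fU: "set_integrable lebesgue U f"
    using set_integrable_bounded_lebesgue[OF Um assms(4) B] .
  \<comment> \<open>The case of a zero second function.\<close>
  have f2U: "set_integrable lebesgue U (\<lambda>x. (norm (f x))\<^sup>2)"
    using set_integrable_norm_diff_square[OF Um assms(4), of "\<lambda>x. 0" B 0] B by simp
  obtain h where h: "continuous_on UNIV h" "bounded (range h)"
    and fh: "(LINT x:U|lebesgue. (norm (f x - h x))\<^sup>2) < r / 4"
    using L2_approx_by_continuous[OF Um assms(4,5), of "r / 4"] \<open>r > 0\<close> by auto
  obtain C where C: "\<And>x. norm (h x) \<le> C"
    using h(2) by (auto simp: bounded_iff)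
  have hU: "continuous_on U h"
    using h(1) continuous_on_subset by blast
  have hm: "h \<in> borel_measurable (lebesgue_on U)"
    using hU Um by (simp add: continuous_imp_measurable_on_sets_lebesgue fmeasurableD)
  have fhU: "set_integrable lebesgue U (\<lambda>x. (norm (f x - h x))\<^sup>2)"
    using set_integrable_norm_diff_square[OF Um assms(4) hm B C] .
  have "uniformly_continuous_on U h"
    using hU \<open>compact U\<close> by (rule compact_uniformly_continuous)
  then obtain d where d: "d > 0"
    "\<And>x y. x \<in> U \<Longrightarrow> y \<in> U \<Longrightarrow> dist x y < d \<Longrightarrow> dist (h x) (h y) < e"
    unfolding uniformly_continuous_on_def using e(1) by metis
  \<comment> \<open>Beyond \<open>N0\<close> the pieces have length \<open>\<mu> / real N\<close>
    below the modulus \<open>d\<close>.\<close>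
  obtain N0 :: nat where N0: "\<mu> / d < real N0"
    using reals_Archimedean2 by blast
  show "\<exists>no. \<forall>N\<ge>no. norm ((\<Sum>i=1..N. jensen_bound f (V N i)) - S_integral f U) < r"
  proof (intro exI allI impI)
    \<comment> \<open>The \<open>+ 1\<close> gives N \<ge> 1 at once, so that the partition
      hypothesis applies and \<open>\<mu> / real N\<close> is a genuine quotient.\<close>
    fix N assume N: "N0 + 1 \<le> N"
    have "\<mu> / d < real N"
      using N0 N by linarith
    then have Nd: "\<mu> / real N < d"
      using d(1) N by (simp add: field_simps)
    have part: "equal_interval_partition U N (V N)"
      using assms(6) N by simp
    have Un: "(\<Union>i\<in>{1..N}. V N i) = U"
      and iv: "\<And>i. i \<in> {1..N} \<Longrightarrow> is_interval (V N i)"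
      and me: "\<And>i. i \<in> {1..N} \<Longrightarrow> measure lebesgue (V N i) = \<mu> / real N"
      and ord: "\<And>i j x y. i \<in> {1..N} \<Longrightarrow> j \<in> {1..N} \<Longrightarrow> i < j \<Longrightarrow> x \<in> V N i \<Longrightarrow> y \<in> V N j \<Longrightarrow> x \<le> y"
      using part unfolding equal_interval_partition_def \<mu>_def by blast+
    have sub: "V N i \<subseteq> U" if "i \<in> {1..N}" for i
      using Un that by blast
    \<comment> \<open>Whichever endpoints a piece contains, it is convex and bounded, hence
      measurable with finite measure.\<close>
    have lm: "V N i \<in> lmeasurable" if "i \<in> {1..N}" for i
      using iv[OF that] sub[OF that] \<open>compact U\<close>
      by (meson bounded_subset compact_imp_bounded is_interval_convex measurable_convex)
    have ls: "V N i \<in> sets lebesgue" if "i \<in> {1..N}" for i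
      using lm[OF that] by (simp add: fmeasurableD)
    have negl: "pairwise (\<lambda>i j. negligible (V N i \<inter> V N j)) {1..N}"
    proof (rule pairwiseI)
      fix i j assume ij: "i \<in> {1..N}" "j \<in> {1..N}" "i \<noteq> j"
      \<comment> \<open>Applying the ordering of the pieces to the two common points in both orders
        gives x \<le> y and y \<le> x, so the overlap has at most one point.\<close>
      have "x = y" if "x \<in> V N i \<inter> V N j" "y \<in> V N i \<inter> V N j" for x y
        using ord[of i j x y] ord[of i j y x] ord[of j i x y] ord[of j i y x] ij that
        by (cases i j rule: linorder_cases) auto
      then have "V N i \<inter> V N j = {} \<or> (\<exists>x. V N i \<inter> V N j = {x})"
        by blast
      then have "finite (V N i \<inter> V N j)"
        by auto
      then show "negligible (V N i \<inter> V N j)"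
        by (rule negligible_finite)
    qed
    have split: "(LINT x:U|lebesgue. g x) = (\<Sum>i=1..N. LINT x:V N i|lebesgue. g x)"
      if "set_integrable lebesgue U g" for g :: "real \<Rightarrow> real"
      using LINT_Union_negligible_overlap[of "{1..N}" "V N" g] that negl ls Un by simp
    have S: "S_integral f U = (\<Sum>i=1..N. S_integral f (V N i))"
      using split[OF f2U] by (simp add: S_integral_def phi_def power2_norm_eq_inner sum_negf)
    have defect: "S_integral f (V N i) \<le> jensen_bound f (V N i) \<and>
        jensen_bound f (V N i) - S_integral f (V N i)
          \<le> 2 * (LINT x:V N i|lebesgue. (norm (f x - h x))\<^sup>2) + 2 * e\<^sup>2 * (\<mu> / real N)"
      if i: "i \<in> {1..N}" for i
    proof -
      let ?A = "V N i"
      have A: "?A \<in> lmeasurable" and As: "?A \<in> sets lebesgue" and AU: "?A \<subseteq> U"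
        using lm ls sub i by auto
      have m: "measure lebesgue ?A > 0"
        using me[OF i] \<mu> N by simp
      have fA: "set_integrable lebesgue ?A f"
        and f2A: "set_integrable lebesgue ?A (\<lambda>x. (norm (f x))\<^sup>2)"
        and fhA: "set_integrable lebesgue ?A (\<lambda>x. (norm (f x - h x))\<^sup>2)"
        using set_integrable_subset[OF fU As AU] set_integrable_subset[OF f2U As AU]
          set_integrable_subset[OF fhU As AU] by auto
      \<comment> \<open>Positive measure provides a sample point \<open>a\<close>; the constant
        compared with \<open>f\<close> on this piece is \<open>h a\<close>.\<close>
      have "?A \<noteq> {}"
        using m by auto
      then obtain a where a: "a \<in> ?A"
        by blast
      have k: "set_integrable lebesgue ?A (\<lambda>x. 2 * e\<^sup>2)"
        using A by (intro set_integrable_bounded_lebesgue) auto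
      have fcA: "set_integrable lebesgue ?A (\<lambda>x. (norm (f x - h a))\<^sup>2)"
        using set_integrable_subset[OF set_integrable_norm_diff_square[OF Um assms(4), of "\<lambda>x. h a" B C] As AU] B C
        by simp
      have "(LINT x:?A|lebesgue. (norm (f x - h a))\<^sup>2)
          \<le> (LINT x:?A|lebesgue. 2 * (norm (f x - h x))\<^sup>2 + 2 * e\<^sup>2)"
      proof (rule set_integral_mono[OF fcA])
        show "set_integrable lebesgue ?A (\<lambda>x. 2 * (norm (f x - h x))\<^sup>2 + 2 * e\<^sup>2)"
          using fhA k by (intro set_integral_add) auto
        fix x assume x: "x \<in> ?A"
        have "dist x a < d"
          using dist_le_measure_interval[OF iv[OF i] A x a] me[OF i] Nd by (simp add: dist_real_def)
        then have "norm (h x - h a) \<le> e"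
          using d(2)[of x a] x a AU by (auto simp: dist_norm less_imp_le subset_iff)
        then have 1: "(norm (h x - h a))\<^sup>2 \<le> e\<^sup>2"
          by (simp add: power_mono)
        have "norm (f x - h a) \<le> norm (f x - h x) + norm (h x - h a)"
          using norm_triangle_ineq[of "f x - h x" "h x - h a"] by simp
        then have "(norm (f x - h a))\<^sup>2 \<le> (norm (f x - h x) + norm (h x - h a))\<^sup>2"
          by (simp add: power_mono)
        \<comment> \<open>The inequality (u + v)^2 \<le> 2 u^2 + 2 v^2 is (u - v)^2 \<ge> 0
          rearranged; it is the source of the factors 2 in the error bound.\<close>
        also have "\<dots> \<le> 2 * (norm (f x - h x))\<^sup>2 + 2 * (norm (h x - h a))\<^sup>2"
          using zero_le_power2[of "norm (f x - h x) - norm (h x - h a)"]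
          by (simp add: power2_diff power2_sum)
        finally show "(norm (f x - h a))\<^sup>2 \<le> 2 * (norm (f x - h x))\<^sup>2 + 2 * e\<^sup>2"
          using 1 by linarith
      qed
      also have "\<dots> = 2 * (LINT x:?A|lebesgue. (norm (f x - h x))\<^sup>2) + (LINT x:?A|lebesgue. 2 * e\<^sup>2)"
        using fhA k by (subst set_integral_add(2)) auto
      also have "(LINT x:?A|lebesgue. 2 * e\<^sup>2) = 2 * e\<^sup>2 * (\<mu> / real N)"
        using As me[OF i] by (simp add: set_lebesgue_integral_def)
      finally show ?thesis
        using jensen_bound_defect[OF A m fA f2A] by (meson order_trans)
    qed
    have "(\<Sum>i=1..N. jensen_bound f (V N i)) - S_integral f U
        = (\<Sum>i=1..N. jensen_bound f (V N i) - S_integral f (V N i))"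
      by (simp add: S sum_subtractf)
    \<comment> \<open>Nonnegativity of each defect removes the absolute value, so only an upper
      bound remains to be found.\<close>
    moreover have "0 \<le> (\<Sum>i=1..N. jensen_bound f (V N i) - S_integral f (V N i))"
      using defect by (intro sum_nonneg) simp
    moreover have "(\<Sum>i=1..N. jensen_bound f (V N i) - S_integral f (V N i))
        \<le> (\<Sum>i=1..N. 2 * (LINT x:V N i|lebesgue. (norm (f x - h x))\<^sup>2) + 2 * e\<^sup>2 * (\<mu> / real N))"
      using defect by (intro sum_mono) simp
    \<comment> \<open>The integrals over the pieces recombine to one over \<open>U\<close>, and the
      \<open>N\<close> equal lengths add up to \<open>\<mu>\<close>, so the bound no longer depends
      on \<open>N\<close>.\<close>
    moreover have "\<dots> = 2 * (LINT x:U|lebesgue. (norm (f x - h x))\<^sup>2) + 2 * (e\<^sup>2 * \<mu>)"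
      using N by (simp add: split[OF fhU] sum.distrib sum_distrib_left)
    moreover have "\<dots> < r"
      using fh e(2) by simp
    ultimately show "norm ((\<Sum>i=1..N. jensen_bound f (V N i)) - S_integral f U) < r"
      by simp
  qed
qed

end
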